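(* For any unimodal range map $\delta$, the quotient space $\mathbf{Cl}_{\bar{\delta}}/\mathcal{V}_\delta$ (with the partial compositions and unit induced from $\mathbf{Cl}_{\bar\delta}$) is an operad.
   Context: $\mathbb{N}=\{0,1,2,\dots\}$ and $\mathbb{K}$ is a field of characteristic zero. Operads are nonsymmetric operads in $\mathbb{K}$-vector spaces, with partial compositions $\circ_i$ and a unit. A range map is a map $\delta:\mathbb{N}\setminus\{0\}\to\mathbb{N}$. It is unimodal if there are no $1\le i_1<i_2<i_3$ with $\delta(i_1)>\delta(i_2)<\delta(i_3)$. For a range map $\delta$, let $\bar{\delta}$ be the (weakly increasing) range map $\bar{\delta}(i):=\max\{\delta(1),\dots,\delta(i)\}$. For a word $w$ on $\mathbb{N}$, $\ell(w)$ is its length, $w(i)$ its $i$-th letter, and $\epsilon$ is the empty word. A $\delta$-cliff is a word $w$ on $\mathbb{N}$ such that $0\le w(i)\le\delta(i)$ for all $1\le i\le\ell(w)$. Its size is $|w|:=\ell(w)+1$. $\mathsf{Cl}_\delta$ is the graded set (by size) of all $\delta$-cliffs; note $\mathsf{Cl}_\delta\subseteq\mathsf{Cl}_{\bar\delta}$. For words $u,v$ and $1\le i\le |u|$, set $u\,\square_i\,v:=u(1)\cdots u(i-1)\;v\;u(i)\cdots u(\ell(u))$. For a weakly increasing range map $\rho$, $\mathbf{Cl}_\rho$ is the operad with basis $\{\mathsf{E}_w:w\in\mathsf{Cl}_\rho\}$, where $\mathsf{E}_w$ has arity $|w|$, partial compositions given by $\mathsf{E}_u\circ_i\mathsf{E}_v:=\mathsf{E}_{u\,\square_i\,v}$,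 and unit $\mathsf{E}_\epsilon$. $\mathcal{V}_\delta$ is the graded subspace of $\mathbf{Cl}_{\bar\delta}$ spanned by $\{\mathsf{E}_w: w\in\mathsf{Cl}_{\bar\delta}\setminus\mathsf{Cl}_\delta\}$. *)

theory Defs
  imports "HOL-Algebra.Module" "HOL-Algebra.QuotRing"
begin

section \<open>Nonsymmetric operads in vector spaces\<close>

text \<open>
  An operad is a family of vector spaces indexed by the arity. As the arity of an element is not
  determined by the element itself (all components share one HOL type), a partial composition
  takes the two arities as arguments: \<^term>\<open>pcomp P n m i x y\<close> stands for $x \circ_i y$ where $x$
  has arity $n$ and $y$ has arity $m$.
\<close>

record ('k, 'a) operad_data =
  component :: "nat \<Rightarrow> ('k, 'a) module"
  pcomp :: "nat \<Rightarrow> nat \<Rightarrow> nat \<Rightarrow> 'a \<Rightarrow> 'a \<Rightarrow> 'a"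
  operad_unit :: 'a

locale ns_operad =
  fixes K :: "('k, 'r) ring_scheme" and P :: "('k, 'a) operad_data"
  assumes field: "field K"
    and vector_space: "\<And>n. module K (component P n)"
    and pcomp_closed:
      "\<And>n m i x y. \<lbrakk>1 \<le> i; i \<le> n; x \<in> carrier (component P n); y \<in> carrier (component P m)\<rbrakk>
        \<Longrightarrow> pcomp P n m i x y \<in> carrier (component P (n + m - 1))"
    and pcomp_add_left:
      "\<And>n m i x x' y. \<lbrakk>1 \<le> i; i \<le> n; x \<in> carrier (component P n);
          x' \<in> carrier (component P n); y \<in> carrier (component P m)\<rbrakk>
        \<Longrightarrow> pcomp P n m i (x \<oplus>\<^bsub>component P n\<^esub> x') y
          = pcomp P n m i x y \<oplus>\<^bsub>component P (n + m - 1)\<^esub> pcomp P n m i x' y"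
    and pcomp_add_right:
      "\<And>n m i x y y'. \<lbrakk>1 \<le> i; i \<le> n; x \<in> carrier (component P n);
          y \<in> carrier (component P m); y' \<in> carrier (component P m)\<rbrakk>
        \<Longrightarrow> pcomp P n m i x (y \<oplus>\<^bsub>component P m\<^esub> y')
          = pcomp P n m i x y \<oplus>\<^bsub>component P (n + m - 1)\<^esub> pcomp P n m i x y'"
    and pcomp_smult_left:
      "\<And>n m i a x y. \<lbrakk>1 \<le> i; i \<le> n; a \<in> carrier K;
          x \<in> carrier (component P n); y \<in> carrier (component P m)\<rbrakk>
        \<Longrightarrow> pcomp P n m i (a \<odot>\<^bsub>component P n\<^esub> x) y
          = a \<odot>\<^bsub>component P (n + m - 1)\<^esub> pcomp P n m i x y"
    and pcomp_smult_right:
      "\<And>n m i a x y. \<lbrakk>1 \<le> i; i \<le> n; a \<in> carrier K;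
          x \<in> carrier (component P n); y \<in> carrier (component P m)\<rbrakk>
        \<Longrightarrow> pcomp P n m i x (a \<odot>\<^bsub>component P m\<^esub> y)
          = a \<odot>\<^bsub>component P (n + m - 1)\<^esub> pcomp P n m i x y"
    and sequential_assoc:
      "\<And>n m k i j x y z. \<lbrakk>1 \<le> i; i \<le> n; 1 \<le> j; j \<le> m; x \<in> carrier (component P n);
          y \<in> carrier (component P m); z \<in> carrier (component P k)\<rbrakk>
        \<Longrightarrow> pcomp P (n + m - 1) k (i + j - 1) (pcomp P n m i x y) z
          = pcomp P n (m + k - 1) i x (pcomp P m k j y z)"
    and parallel_assoc:
      "\<And>n m k i j x y z. \<lbrakk>1 \<le> i; i < j; j \<le> n; x \<in> carrier (component P n);
          y \<in> carrier (component P m); z \<in> carrier (component P k)\<rbrakk>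
        \<Longrightarrow> pcomp P (n + m - 1) k (j + m - 1) (pcomp P n m i x y) z
          = pcomp P (n + k - 1) m i (pcomp P n k j x z) y"
    and unit_closed: "operad_unit P \<in> carrier (component P 1)"
    and unit_left:
      "\<And>n x. x \<in> carrier (component P n) \<Longrightarrow> pcomp P 1 n 1 (operad_unit P) x = x"
    and unit_right:
      "\<And>n i x. \<lbrakk>1 \<le> i; i \<le> n; x \<in> carrier (component P n)\<rbrakk>
        \<Longrightarrow> pcomp P n 1 i x (operad_unit P) = x"


section \<open>Quotients\<close>

text \<open>
  The conventions are those of \<^const>\<open>FactRing\<close>: the operation induced on cosets is the union of
  the cosets of all results on representatives. This union is again a coset exactly when the
  result does not depend on the representatives, so that \<^const>\<open>ns_operad\<close>, whose components are
  required to be closed under the partial compositions, includes well-definedness on the quotient.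
  The ring fields \<^const>\<open>mult\<close> and \<^const>\<open>one\<close> of a module record carry no meaning.
\<close>

definition quotient_module :: "('k, 'a) module \<Rightarrow> 'a set \<Rightarrow> ('k, 'a set) module" where
  "quotient_module M N =
    \<lparr>carrier = a_rcosets\<^bsub>M\<^esub> N, mult = undefined, one = undefined, zero = N, add = set_add M,
     smult = (\<lambda>a C. \<Union>x\<in>C. N +>\<^bsub>M\<^esub> (a \<odot>\<^bsub>M\<^esub> x))\<rparr>"

definition quotient_operad ::
    "('k, 'a) operad_data \<Rightarrow> (nat \<Rightarrow> 'a set) \<Rightarrow> ('k, 'a set) operad_data" where
  "quotient_operad P V =
    \<lparr>component = (\<lambda>n. quotient_module (component P n) (V n)),
     pcomp = (\<lambda>n m i C D. \<Union>x\<in>C. \<Union>y\<in>D.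
        V (n + m - 1) +>\<^bsub>component P (n + m - 1)\<^esub> pcomp P n m i x y),
     operad_unit = V 1 +>\<^bsub>component P 1\<^esub> operad_unit P\<rparr>"


section \<open>Free modules and spans\<close>

definition supp :: "('k, 'r) ring_scheme \<Rightarrow> ('b \<Rightarrow> 'k) \<Rightarrow> 'b set" where
  "supp K x = {b. x b \<noteq> \<zero>\<^bsub>K\<^esub>}"

definition free_module :: "('k, 'r) ring_scheme \<Rightarrow> 'b set \<Rightarrow> ('k, 'b \<Rightarrow> 'k) module" where
  "free_module K B =
    \<lparr>carrier = {x. range x \<subseteq> carrier K \<and> finite (supp K x) \<and> supp K x \<subseteq> B},
     mult = undefined, one = undefined, zero = (\<lambda>b. \<zero>\<^bsub>K\<^esub>), add = (\<lambda>x y b. x b \<oplus>\<^bsub>K\<^esub> y b),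
     smult = (\<lambda>a x b. a \<otimes>\<^bsub>K\<^esub> x b)\<rparr>"

definition basis_elem :: "('k, 'r) ring_scheme \<Rightarrow> 'b \<Rightarrow> ('b \<Rightarrow> 'k)" where
  "basis_elem K b = (\<lambda>c. if c = b then \<one>\<^bsub>K\<^esub> else \<zero>\<^bsub>K\<^esub>)"

definition module_span :: "('k, 'r) ring_scheme \<Rightarrow> ('k, 'a) module \<Rightarrow> 'a set \<Rightarrow> 'a set" where
  "module_span K M S = \<Inter>{N. submodule N K M \<and> S \<subseteq> N}"

definition char_zero :: "('k, 'r) ring_scheme \<Rightarrow> bool" where
  "char_zero K \<longleftrightarrow> (\<forall>n::nat. n > 0 \<longrightarrow> [n] \<cdot>\<^bsub>K\<^esub> \<one>\<^bsub>K\<^esub> \<noteq> \<zero>\<^bsub>K\<^esub>)"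


section \<open>Range maps and cliffs\<close>

text \<open>
  A range map is a function on the positive integers; it is represented by a function on
  \<^typ>\<open>nat\<close> whose value at 0 is never used. Words are lists, whose letters are counted from 0 in
  HOL, whence the shift in \<^term>\<open>w ! (i - 1)\<close>.
\<close>

definition unimodal :: "(nat \<Rightarrow> nat) \<Rightarrow> bool" where
  "unimodal \<delta> \<longleftrightarrow>
    \<not> (\<exists>i1 i2 i3. 1 \<le> i1 \<and> i1 < i2 \<and> i2 < i3 \<and> \<delta> i1 > \<delta> i2 \<and> \<delta> i2 < \<delta> i3)"

definition range_bar :: "(nat \<Rightarrow> nat) \<Rightarrow> nat \<Rightarrow> nat" where
  "range_bar \<delta> i = Max (\<delta> ` {1..i})"

definition cliffs :: "(nat \<Rightarrow> nat) \<Rightarrow> nat list set" where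
  "cliffs \<delta> = {w. \<forall>i\<in>{1..length w}. w ! (i - 1) \<le> \<delta> i}"

definition word_size :: "nat list \<Rightarrow> nat" where
  "word_size w = length w + 1"

definition word_insert :: "nat list \<Rightarrow> nat \<Rightarrow> nat list \<Rightarrow> nat list" where
  "word_insert u i v = take (i - 1) u @ v @ drop (i - 1) u"


section \<open>Cliff operads\<close>

definition cliff_space ::
    "('k, 'r) ring_scheme \<Rightarrow> (nat \<Rightarrow> nat) \<Rightarrow> nat \<Rightarrow> ('k, nat list \<Rightarrow> 'k) module" where
  "cliff_space K \<rho> n = free_module K {w \<in> cliffs \<rho>. word_size w = n}"

text \<open>
  The partial composition is the bilinear extension of
  $\mathsf{E}_u \circ_i \mathsf{E}_v = \mathsf{E}_{u \mathbin{\square_i} v}$.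
\<close>

definition cliff_operad ::
    "('k, 'r) ring_scheme \<Rightarrow> (nat \<Rightarrow> nat) \<Rightarrow> ('k, nat list \<Rightarrow> 'k) operad_data" where
  "cliff_operad K \<rho> =
    \<lparr>component = cliff_space K \<rho>,
     pcomp = (\<lambda>n m i x y.
        \<Oplus>\<^bsub>cliff_space K \<rho> (n + m - 1)\<^esub> u \<in> supp K x.
          \<Oplus>\<^bsub>cliff_space K \<rho> (n + m - 1)\<^esub> v \<in> supp K y.
            (x u \<otimes>\<^bsub>K\<^esub> y v) \<odot>\<^bsub>cliff_space K \<rho> (n + m - 1)\<^esub> basis_elem K (word_insert u i v)),
     operad_unit = basis_elem K []\<rparr>"

definition non_cliff_space ::
    "('k, 'r) ring_scheme \<Rightarrow> (nat \<Rightarrow> nat) \<Rightarrow> nat \<Rightarrow> (nat list \<Rightarrow> 'k) set" where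
  "non_cliff_space K \<delta> n =
    module_span K (cliff_space K (range_bar \<delta>) n)
      (basis_elem K ` {w \<in> cliffs (range_bar \<delta>) - cliffs \<delta>. word_size w = n})"

end

theory Submission
  imports Defs
begin

text \<open>
  A quotient by an operadic ideal is an operad, so it has to be shown that inserting a word into
  another one yields a non-\<open>\<delta>\<close>-cliff as soon as one of the two is not a \<open>\<delta>\<close>-cliff. If both words
  are \<open>range_bar \<delta>\<close>-cliffs, the guilty letter stands at a position where \<open>\<delta>\<close> is below its running
  maximum; by unimodality \<open>\<delta>\<close> does not exceed its value there at later positions, and an insertion
  only moves letters to the right.
\<close>

section \<open>Quotients of modules\<close>

lemma (in abelian_subgroup) coset_absorb:
  assumes "h \<in> H" "x \<in> carrier G"
  shows "H +> (h \<oplus> x) = H +> x"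
  using a_repr_independence[OF a_rcosI[OF assms(1) a_subset assms(2)] assms(2) a_subgroup] by simp

text \<open>Quotient operations are unions over all representatives. A function constant on a coset
  makes such a union collapse to its value; that \<open>H\<close> contains zero excludes the empty
  union.\<close>

lemma (in abelian_subgroup) UN_coset_eq:
  assumes "\<And>h. h \<in> H \<Longrightarrow> f (h \<oplus> x) = c"
  shows "(\<Union>z\<in>H +> x. f z) = c"
proof -
  have "H +> x = (\<lambda>h. h \<oplus> x) ` H"
    unfolding a_r_coset_def' by auto
  moreover have "H \<noteq> {}"
    using additive_subgroup.zero_closed[OF additive_subgroup_axioms] by blast
  ultimately show ?thesis
    using assms by simp
qed

lemma (in abelian_subgroup) a_rcosetsE:
  assumes "C \<in> a_rcosets H"
  obtains x where "x \<in> carrier G" "C = H +> x"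
  using assms unfolding A_RCOSETS_def' by auto

locale module_quotient = module R M
  for R :: "('k, 'r) ring_scheme" (structure) and M :: "('k, 'a) module" (structure) +
  fixes N
  assumes submodule: "submodule N R M"

sublocale module_quotient \<subseteq> abelian_subgroup N M
  by (intro abelian_subgroupI3 additive_subgroupI submodule.axioms(1)[OF submodule]
      abelian_group_axioms)

context module_quotient
begin

text \<open>Changing the representative by \<open>h\<close> in \<open>N\<close> changes the result
  by the multiple of \<open>h\<close> by \<open>a\<close>, which stays in \<open>N\<close>.\<close>

lemma quotient_smult:
  assumes "a \<in> carrier R" "x \<in> carrier M"
  shows "a \<odot>\<^bsub>quotient_module M N\<^esub> (N +>\<^bsub>M\<^esub> x) = N +>\<^bsub>M\<^esub> (a \<odot>\<^bsub>M\<^esub> x)"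
proof -
  have "N +>\<^bsub>M\<^esub> (a \<odot>\<^bsub>M\<^esub> (h \<oplus>\<^bsub>M\<^esub> x)) = N +>\<^bsub>M\<^esub> (a \<odot>\<^bsub>M\<^esub> x)" if "h \<in> N" for h
    using that assms a_subset coset_absorb[of "a \<odot>\<^bsub>M\<^esub> h" "a \<odot>\<^bsub>M\<^esub> x"]
      submodule.smult_closed[OF submodule assms(1) that] by (auto simp: smult_r_distr)
  then show ?thesis
    by (simp add: quotient_module_def UN_coset_eq)
qed

lemma quotient_add:
  assumes "x \<in> carrier M" "y \<in> carrier M"
  shows "(N +>\<^bsub>M\<^esub> x) \<oplus>\<^bsub>quotient_module M N\<^esub> (N +>\<^bsub>M\<^esub> y) = N +>\<^bsub>M\<^esub> (x \<oplus>\<^bsub>M\<^esub> y)"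
  using assms by (simp add: quotient_module_def a_rcos_sum)

lemma coset_in_quotient:
  "x \<in> carrier M \<Longrightarrow> N +>\<^bsub>M\<^esub> x \<in> carrier (quotient_module M N)"
  by (simp add: quotient_module_def a_rcosetsI a_subset)

lemma quotient_carrierE:
  assumes "C \<in> carrier (quotient_module M N)"
  obtains x where "x \<in> carrier M" "C = N +>\<^bsub>M\<^esub> x"
  using assms by (auto simp: quotient_module_def elim: a_rcosetsE)

lemma module_quotient: "module R (quotient_module M N)"
proof (rule moduleI)
  let ?Q = "quotient_module M N"
  show "cring R" by (rule R.is_cring)
  \<comment> \<open>Written as the coset of zero, the neutral element has a representative too, so
    each group axiom reduces to the same axiom in \<open>M\<close>.\<close>
  have zero: "\<zero>\<^bsub>?Q\<^esub> = N +>\<^bsub>M\<^esub> \<zero>\<^bsub>M\<^esub>"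
    by (simp add: quotient_module_def a_subset)
  show "abelian_group ?Q"
  proof (rule abelian_groupI)
    show "\<zero>\<^bsub>?Q\<^esub> \<in> carrier ?Q"
      unfolding zero by (rule coset_in_quotient) simp
  next
    fix C D assume C: "C \<in> carrier ?Q" and D: "D \<in> carrier ?Q"
    then show "C \<oplus>\<^bsub>?Q\<^esub> D \<in> carrier ?Q"
      by (elim quotient_carrierE) (simp only: quotient_add coset_in_quotient M.a_closed)
    show "C \<oplus>\<^bsub>?Q\<^esub> D = D \<oplus>\<^bsub>?Q\<^esub> C"
      using C D by (elim quotient_carrierE) (simp only: quotient_add M.a_comm)
    show "C \<oplus>\<^bsub>?Q\<^esub> D \<oplus>\<^bsub>?Q\<^esub> E = C \<oplus>\<^bsub>?Q\<^esub> (D \<oplus>\<^bsub>?Q\<^esub> E)" if "E \<in> carrier ?Q" for E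
      using C D that
      by (elim quotient_carrierE) (simp only: quotient_add M.a_closed M.a_assoc)
  next
    fix C assume "C \<in> carrier ?Q"
    then obtain x where x: "x \<in> carrier M" "C = N +>\<^bsub>M\<^esub> x"
      by (rule quotient_carrierE)
    then show "\<zero>\<^bsub>?Q\<^esub> \<oplus>\<^bsub>?Q\<^esub> C = C"
      by (simp only: zero quotient_add M.zero_closed M.l_zero)
    from x have "(N +>\<^bsub>M\<^esub> \<ominus>\<^bsub>M\<^esub> x) \<oplus>\<^bsub>?Q\<^esub> C = \<zero>\<^bsub>?Q\<^esub>"
      by (simp only: zero quotient_add M.a_inv_closed M.l_neg)
    with x show "\<exists>D\<in>carrier ?Q. D \<oplus>\<^bsub>?Q\<^esub> C = \<zero>\<^bsub>?Q\<^esub>"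
      using coset_in_quotient by blast
  qed
\<comment> \<open>The remaining module axioms: choose representatives, move all operations onto
  them, and use the axiom in \<open>M\<close>.\<close>
qed (elim quotient_carrierE; simp only: quotient_smult quotient_add coset_in_quotient
    smult_closed R.a_closed R.m_closed M.a_closed smult_l_distr smult_r_distr smult_assoc1
    R.one_closed smult_one)+

end


section \<open>Quotients of operads\<close>

locale operad_ideal = ns_operad +
  fixes V :: "nat \<Rightarrow> 'c set"
  assumes submodule: "\<And>n. submodule (V n) K (component P n)"
    and pcomp_ideal_left:
      "\<And>n m i x y. \<lbrakk>1 \<le> i; i \<le> n; x \<in> V n; y \<in> carrier (component P m)\<rbrakk>
        \<Longrightarrow> pcomp P n m i x y \<in> V (n + m - 1)"
    and pcomp_ideal_right:
      "\<And>n m i x y. \<lbrakk>1 \<le> i; i \<le> n; x \<in> carrier (component P n); y \<in> V m\<rbrakk>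
        \<Longrightarrow> pcomp P n m i x y \<in> V (n + m - 1)"
begin

abbreviation coset where
  "coset n x \<equiv> V n +>\<^bsub>component P n\<^esub> x"

lemma module_quotient_ideal: "module_quotient K (component P n) (V n)"
  by (intro module_quotient.intro module_quotient_axioms.intro vector_space submodule)

lemma abelian_subgroup_ideal: "abelian_subgroup (V n) (component P n)"
proof -
  interpret module_quotient K "component P n" "V n" by (rule module_quotient_ideal)
  show ?thesis by unfold_locales
qed

lemma ideal_subset: "x \<in> V n \<Longrightarrow> x \<in> carrier (component P n)"
  using additive_subgroup.a_subset[OF abelian_subgroup.axioms(1)[OF abelian_subgroup_ideal]] by blast

lemma quotient_pcomp:
  assumes i: "1 \<le> i" "i \<le> n"
    and x: "x \<in> carrier (component P n)" and y: "y \<in> carrier (component P m)"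
  shows "pcomp (quotient_operad P V) n m i (coset n x) (coset m y)
    = coset (n + m - 1) (pcomp P n m i x y)"
proof -
  note sum_closed = abelian_monoid.a_closed[OF abelian_group.axioms(1)[OF module.axioms(2)[OF vector_space]]]
  note absorb = abelian_subgroup.coset_absorb[OF abelian_subgroup_ideal]
  have "coset (n + m - 1) (pcomp P n m i (h \<oplus>\<^bsub>component P n\<^esub> x) (g \<oplus>\<^bsub>component P m\<^esub> y))
      = coset (n + m - 1) (pcomp P n m i x y)"
    if h: "h \<in> V n" and g: "g \<in> V m" for h g
  proof -
    have gy: "g \<oplus>\<^bsub>component P m\<^esub> y \<in> carrier (component P m)"
      using sum_closed ideal_subset[OF g] y by blast
    \<comment> \<open>Bilinear expansion, left argument first: the terms with \<open>h\<close> on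
      the left and \<open>g\<close> on the right lie in the ideal, and the coset absorbs them one
      after the other.\<close>
    have "pcomp P n m i (h \<oplus>\<^bsub>component P n\<^esub> x) (g \<oplus>\<^bsub>component P m\<^esub> y)
        = pcomp P n m i h (g \<oplus>\<^bsub>component P m\<^esub> y) \<oplus>\<^bsub>component P (n + m - 1)\<^esub>
          (pcomp P n m i x g \<oplus>\<^bsub>component P (n + m - 1)\<^esub> pcomp P n m i x y)"
      using i x y gy ideal_subset[OF h] ideal_subset[OF g]
      by (simp only: pcomp_add_left pcomp_add_right)
    then show ?thesis
      using i x y gy h g ideal_subset[OF h] ideal_subset[OF g]
      by (simp only: absorb pcomp_ideal_left pcomp_ideal_right pcomp_closed sum_closed)
  qed
  then show ?thesis
    by (simp add: quotient_operad_def
        abelian_subgroup.UN_coset_eq[OF abelian_subgroup_ideal])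
qed

lemma quotient_component:
  "component (quotient_operad P V) n = quotient_module (component P n) (V n)"
  by (simp add: quotient_operad_def)

lemma quotient_unit: "operad_unit (quotient_operad P V) = coset 1 (operad_unit P)"
  by (simp add: quotient_operad_def)

theorem ns_operad_quotient: "ns_operad K (quotient_operad P V)"
proof -
  note E = module_quotient.quotient_carrierE[OF module_quotient_ideal]
  note in_quotient = module_quotient.coset_in_quotient[OF module_quotient_ideal]
  note add = module_quotient.quotient_add[OF module_quotient_ideal]
  note smult = module_quotient.quotient_smult[OF module_quotient_ideal]
  note sum_closed = abelian_monoid.a_closed[OF abelian_group.axioms(1)[OF module.axioms(2)[OF vector_space]]]
  note smult_closed = module.smult_closed[OF vector_space]
  note rules = quotient_component quotient_unit quotient_pcomp in_quotient add smult
    sum_closed smult_closed pcomp_closed unit_closed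
  show ?thesis
  proof (rule ns_operad.intro, unfold quotient_component, goal_cases)
    case 1 show ?case by (rule field)
  next
    case (2 n) show ?case by (rule module_quotient.module_quotient[OF module_quotient_ideal])
  next
    case 3 then show ?case by (elim E) (simp only: rules)
  next
    case 4 then show ?case by (elim E) (simp only: rules pcomp_add_left)
  next
    case 5 then show ?case by (elim E) (simp only: rules pcomp_add_right)
  next
    case 6 then show ?case by (elim E) (simp only: rules pcomp_smult_left)
  next
    case 7 then show ?case by (elim E) (simp only: rules pcomp_smult_right)
  next
    case (8 n m k i j)
    \<comment> \<open>The two sides of the axiom write the same arity differently. Subtraction being
      truncated, the equality rests on \<open>1 \<le> m\<close>, which follows from the bounds on
      \<open>j\<close>.\<close>
    then have "1 \<le> i + j - 1" "i + j - 1 \<le> n + m - 1"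
      and "n + (m + k - 1) - 1 = n + m - 1 + k - 1" by auto
    with 8 show ?case
      by (elim E) (simp only: rules sequential_assoc)
  next
    case (9 n m k i j)
    then have "1 \<le> j + m - 1" "j + m - 1 \<le> n + m - 1" "i \<le> n + k - 1" "i \<le> n" "1 \<le> j"
      and "n + k - 1 + m - 1 = n + m - 1 + k - 1" by auto
    with 9 show ?case
      by (elim E) (simp only: rules parallel_assoc)
  next
    case 10 show ?case by (simp only: rules)
  next
    case 11
    then show ?case
      by (elim E) (simp only: rules unit_left order_refl add_diff_cancel_left')
  next
    case 12
    then show ?case
      by (elim E) (simp only: rules unit_right add_diff_cancel_right')
  qed
qed

end


section \<open>Free modules\<close>

lemma free_module_simps [simp]:
  "carrier (free_module K B) = {x. (\<forall>b. x b \<in> carrier K) \<and> finite (supp K x) \<and> supp K x \<subseteq> B}"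
  "zero (free_module K B) = (\<lambda>b. \<zero>\<^bsub>K\<^esub>)"
  "add (free_module K B) = (\<lambda>x y b. x b \<oplus>\<^bsub>K\<^esub> y b)"
  "smult (free_module K B) = (\<lambda>a x b. a \<otimes>\<^bsub>K\<^esub> x b)"
  by (auto simp: free_module_def)

context cring
begin

lemma free_module_carrierI:
  assumes "\<And>b. x b \<in> carrier R" "finite F" "supp R x \<subseteq> F" "supp R x \<subseteq> B"
  shows "x \<in> carrier (free_module R B)"
  using assms finite_subset by auto

lemma free_module_closed:
  assumes "x \<in> carrier (free_module R B)"
  shows "x b \<in> carrier R"
  using assms by auto

lemma free_module_eq_zero:
  assumes "x \<in> carrier (free_module R B)" "b \<notin> B"
  shows "x b = \<zero>"
  using assms by (auto simp: supp_def)

lemma module_free_module: "module R (free_module R B)"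
proof (rule moduleI)
  show "cring R" by (rule is_cring)
  have add: "x \<oplus>\<^bsub>free_module R B\<^esub> y \<in> carrier (free_module R B)"
    if "x \<in> carrier (free_module R B)" "y \<in> carrier (free_module R B)" for x y
  proof (rule free_module_carrierI[where F = "supp R x \<union> supp R y"])
    have "supp R (x \<oplus>\<^bsub>free_module R B\<^esub> y) \<subseteq> supp R x \<union> supp R y"
      using that by (auto simp: supp_def)
    with that show "supp R (x \<oplus>\<^bsub>free_module R B\<^esub> y) \<subseteq> supp R x \<union> supp R y"
      "supp R (x \<oplus>\<^bsub>free_module R B\<^esub> y) \<subseteq> B"
      by auto
  qed (use that in auto)
  show "abelian_group (free_module R B)"
  proof (rule abelian_groupI)
    fix x assume x: "x \<in> carrier (free_module R B)"
    have "(\<lambda>b. \<ominus> x b) \<in> carrier (free_module R B)"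
      using x by (intro free_module_carrierI[where F = "supp R x"]) (auto simp: supp_def)
    moreover have "(\<lambda>b. \<ominus> x b) \<oplus>\<^bsub>free_module R B\<^esub> x = \<zero>\<^bsub>free_module R B\<^esub>"
      using x by (auto simp: l_neg)
    ultimately show "\<exists>y\<in>carrier (free_module R B). y \<oplus>\<^bsub>free_module R B\<^esub> x = \<zero>\<^bsub>free_module R B\<^esub>"
      by blast
  qed (use add in \<open>auto simp: a_ac supp_def intro!: ext\<close>)
next
  show "a \<odot>\<^bsub>free_module R B\<^esub> x \<in> carrier (free_module R B)"
    if "a \<in> carrier R" "x \<in> carrier (free_module R B)" for a x
    using that by (intro free_module_carrierI[where F = "supp R x"]) (auto simp: supp_def)
qed (simp_all add: l_distr r_distr m_assoc)

lemma basis_elem_closed: "b \<in> B \<Longrightarrow> basis_elem R b \<in> carrier (free_module R B)"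
  by (intro free_module_carrierI[where F = "{b}"]) (auto simp: supp_def basis_elem_def)

lemma finsum_free_module:
  assumes "f \<in> A \<rightarrow> carrier (free_module R B)"
  shows "finsum (free_module R B) f A b = (\<Oplus>a\<in>A. f a b)"
proof -
  interpret M: module R "free_module R B" by (rule module_free_module)
  show ?thesis using assms
  proof (induction A rule: infinite_finite_induct)
    case (insert a A)
    then have f: "f \<in> A \<rightarrow> carrier (free_module R B)" "f a \<in> carrier (free_module R B)"
      by (simp_all add: Pi_def del: free_module_simps)
    moreover have "(\<lambda>a. f a b) \<in> A \<rightarrow> carrier R" "f a b \<in> carrier R"
      using free_module_closed[OF funcset_mem[OF f(1)]] free_module_closed[OF f(2)] by simp_all
    ultimately show ?case
      using M.finsum_insert[OF insert.hyps f] finsum_insert[OF insert.hyps, of "\<lambda>a. f a b"]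
        insert.IH[OF f(1)] by simp
  \<comment> \<open>For infinite \<open>A\<close> both sums are zero by convention, so no finiteness
    has to be assumed.\<close>
  qed (simp_all add: M.finsum_infinite finsum_infinite)
qed

lemma submodule_free_module:
  assumes "S \<subseteq> B"
  shows "submodule (carrier (free_module R S)) R (free_module R B)"
proof -
  interpret B: module R "free_module R B" by (rule module_free_module)
  interpret S: module R "free_module R S" by (rule module_free_module)
  \<comment> \<open>The operations do not mention the basis, so changing the basis only changes the
    carrier.\<close>
  have "(free_module R B)\<lparr>carrier := carrier (free_module R S)\<rparr> = free_module R S"
    by (simp add: free_module_def)
  then show ?thesis
    using assms S.module_axioms by (intro B.module_incl_imp_submodule) auto
qed

text \<open>The functions supported in \<open>S\<close> form a submodule containing these basis
  elements. Conversely each of them is reached by induction on a finite set containing its support: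
  set one coordinate to zero and add back the matching multiple of a basis element.\<close>

lemma module_span_basis:
  assumes "S \<subseteq> B"
  shows "module_span R (free_module R B) (basis_elem R ` S) = carrier (free_module R S)"
proof
  show "module_span R (free_module R B) (basis_elem R ` S) \<subseteq> carrier (free_module R S)"
    unfolding module_span_def
  proof (rule Inter_lower, intro CollectI conjI submodule_free_module[OF assms])
    show "basis_elem R ` S \<subseteq> carrier (free_module R S)"
      by (intro image_subsetI basis_elem_closed)
  qed
next
  have "x \<in> N"
    if N: "submodule N R (free_module R B)" and sub: "basis_elem R ` S \<subseteq> N"
      and "finite F" "F \<subseteq> S" and "\<And>b. x b \<in> carrier R" "supp R x \<subseteq> F" for N F x
    using that(3-)
  proof (induction F arbitrary: x rule: finite_induct)
    case empty
    then have "x = \<zero>\<^bsub>free_module R B\<^esub>" by (auto simp: supp_def)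
    then show ?case
      using subgroup.one_closed[OF submodule.axioms(1)[OF N]] by simp
  next
    case (insert b F)
    have 1: "x(b := \<zero>) \<in> N"
      using insert by (intro insert.IH) (auto simp: supp_def split: if_splits)
    have 2: "x b \<odot>\<^bsub>free_module R B\<^esub> basis_elem R b \<in> N"
      using insert sub by (intro submodule.smult_closed[OF N]) auto
    have "x = x b \<odot>\<^bsub>free_module R B\<^esub> basis_elem R b \<oplus>\<^bsub>free_module R B\<^esub> x(b := \<zero>)"
      using insert.prems by (auto simp: basis_elem_def intro!: ext)
    then show ?case
      using subgroup.m_closed[OF submodule.axioms(1)[OF N] 2 1] by simp
  qed
  then show "carrier (free_module R S) \<subseteq> module_span R (free_module R B) (basis_elem R ` S)"
    unfolding module_span_def by (auto simp:)
qed

end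


section \<open>Cutting words\<close>

text \<open>Inverse of insertion, together with \<open>inner_word\<close>: \<open>p\<close> is the
  number of letters in front of the inserted factor and \<open>l\<close> the length of that
  factor.\<close>

definition outer_word :: "nat \<Rightarrow> nat \<Rightarrow> nat list \<Rightarrow> nat list" where
  "outer_word p l w = take p w @ drop (p + l) w"

definition inner_word :: "nat \<Rightarrow> nat \<Rightarrow> nat list \<Rightarrow> nat list" where
  "inner_word p l w = take l (drop p w)"

lemma outer_word_insert:
  "p \<le> length u \<Longrightarrow> outer_word p (length v) (word_insert u (Suc p) v) = u"
  by (simp add: outer_word_def word_insert_def)

lemma inner_word_insert:
  "p \<le> length u \<Longrightarrow> inner_word p (length v) (word_insert u (Suc p) v) = v"
  by (simp add: inner_word_def word_insert_def)

text \<open>The hypothesis forces \<open>p \<le> length w\<close>. The cut factor is shorter than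
  \<open>l\<close> if \<open>w\<close> ends early, but reinserting it still gives back
  \<open>w\<close>.\<close>

lemma word_insert_outer_inner:
  assumes "p \<le> length (outer_word p l w)"
  shows "word_insert (outer_word p l w) (Suc p) (inner_word p l w) = w"
proof -
  have "p \<le> length w"
    using assms by (auto simp: outer_word_def min_def split: if_splits)
  moreover have "take l (drop p w) @ drop (p + l) w = drop p w"
    by (metis add.commute append_take_drop_id drop_drop)
  ultimately show ?thesis
    by (simp add: outer_word_def inner_word_def word_insert_def)
qed

text \<open>This and the next two lemmas are sequential associativity on words: the factor of length
  \<open>r\<close> sits inside the factor at \<open>p\<close>, whose length is \<open>l\<close>
  without it and \<open>l + r\<close> with it.\<close>

lemma outer_outer_sequential:
  "q \<le> l \<Longrightarrow> outer_word p l (outer_word (p + q) r w) = outer_word p (l + r) w"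
  by (cases "p + q \<le> length w") (auto simp: outer_word_def min_def add_ac)

lemma inner_outer_sequential:
  "q \<le> l \<Longrightarrow> inner_word p l (outer_word (p + q) r w) = outer_word q r (inner_word p (l + r) w)"
  by (cases "p + q \<le> length w") (auto simp: outer_word_def inner_word_def min_def add_ac take_drop)

lemma inner_sequential:
  "q \<le> l \<Longrightarrow> inner_word (p + q) r w = inner_word q r (inner_word p (l + r) w)"
  by (auto simp: inner_word_def min_def add_ac drop_take)

text \<open>This and the next two lemmas are parallel associativity on words: the two factors are
  disjoint, and cutting the left one first shifts the right one from \<open>q + l\<close> to
  \<open>q\<close>.\<close>

lemma outer_outer_parallel:
  "p < q \<Longrightarrow> outer_word p l (outer_word (q + l) r w) = outer_word q r (outer_word p l w)"
  by (cases "p \<le> length w") (auto simp: outer_word_def min_def add_ac take_drop)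

lemma inner_outer_parallel:
  "p < q \<Longrightarrow> inner_word p l (outer_word (q + l) r w) = inner_word p l w"
  by (cases "q + l \<le> length w") (auto simp: outer_word_def inner_word_def min_def add_ac take_drop)

lemma inner_parallel:
  "p < q \<Longrightarrow> inner_word (q + l) r w = inner_word q r (outer_word p l w)"
  by (cases "p \<le> length w") (auto simp: inner_word_def outer_word_def min_def add_ac)


section \<open>Inserting words into cliffs\<close>

lemma length_word_insert: "p \<le> length u \<Longrightarrow> length (word_insert u (Suc p) v) = length u + length v"
  by (simp add: word_insert_def)

lemma nth_word_insert:
  assumes "p \<le> length u"
  shows "word_insert u (Suc p) v ! k =
    (if k < p then u ! k else if k < p + length v then v ! (k - p) else u ! (k - length v))"
  using assms by (auto simp: word_insert_def nth_append)

lemma cliffs_iff: "w \<in> cliffs \<delta> \<longleftrightarrow> (\<forall>k<length w. w ! k \<le> \<delta> (Suc k))"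
proof -
  have "{1..length w} = Suc ` {..<length w}"
    by (simp add: image_Suc_lessThan)
  then show ?thesis
    unfolding cliffs_def by (simp only: mem_Collect_eq) auto
qed

text \<open>Every letter of \<open>u\<close> and \<open>v\<close> keeps its position or moves to the
  right, where a weakly increasing bound is no stricter.\<close>

lemma word_insert_in_cliffs:
  assumes \<rho>: "mono_on {1..} \<rho>" and p: "p \<le> length u"
    and u: "u \<in> cliffs \<rho>" and v: "v \<in> cliffs \<rho>"
  shows "word_insert u (Suc p) v \<in> cliffs \<rho>"
  unfolding cliffs_iff
proof (intro allI impI)
  fix k assume k: "k < length (word_insert u (Suc p) v)"
  have \<rho>: "\<rho> (Suc a) \<le> \<rho> (Suc b)" if "a \<le> b" for a b
    using that by (intro mono_onD[OF \<rho>]) auto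
  consider "k < p" | "p \<le> k" "k < p + length v" | "p + length v \<le> k"
    by linarith
  then show "word_insert u (Suc p) v ! k \<le> \<rho> (Suc k)"
  proof cases
    case 1
    then show ?thesis using u p by (simp add: nth_word_insert cliffs_iff)
  next
    case 2
    then have "v ! (k - p) \<le> \<rho> (Suc (k - p))" using v by (simp add: cliffs_iff)
    also have "\<dots> \<le> \<rho> (Suc k)" by (rule \<rho>) simp
    finally show ?thesis using 2 p by (simp add: nth_word_insert)
  next
    case 3
    then have "u ! (k - length v) \<le> \<rho> (Suc (k - length v))"
      using u k p by (simp add: cliffs_iff length_word_insert)
    also have "\<dots> \<le> \<rho> (Suc k)" by (rule \<rho>) simp
    finally show ?thesis using 3 p by (simp add: nth_word_insert)
  qed
qed

section \<open>Unimodality and persistence of non-cliffs\<close>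

lemma mono_on_range_bar: "mono_on {1..} (range_bar \<delta>)"
proof (rule mono_onI)
  fix i j :: nat assume "i \<in> {1..}" "j \<in> {1..}" "i \<le> j"
  then show "range_bar \<delta> i \<le> range_bar \<delta> j"
    unfolding range_bar_def by (intro Max_mono image_mono) auto
qed

text \<open>The running maximum is attained at some \<open>h < i\<close> with a larger value than at
  \<open>i\<close>; a later value above \<open>\<delta> i\<close> would then make a valley at
  \<open>i\<close>.\<close>

lemma unimodal_after_peak:
  assumes "unimodal \<delta>" "1 \<le> i" "i \<le> j" "\<delta> i < range_bar \<delta> i"
  shows "\<delta> j \<le> \<delta> i"
proof -
  have "range_bar \<delta> i \<in> \<delta> ` {1..i}"
    unfolding range_bar_def using assms(2) by (intro Max_in) auto
  then obtain h where "1 \<le> h" "h \<le> i" "\<delta> i < \<delta> h"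
    using assms(4) by auto
  then have "h < i"
    by (cases "h = i") auto
  show ?thesis
  proof (rule ccontr)
    assume "\<not> \<delta> j \<le> \<delta> i"
    then have "i < j"
      using \<open>i \<le> j\<close> by (cases "i = j") auto
    then show False
      using assms(1) \<open>1 \<le> h\<close> \<open>h < i\<close> \<open>\<delta> i < \<delta> h\<close> \<open>\<not> \<delta> j \<le> \<delta> i\<close>
      unfolding unimodal_def by (metis not_le)
  qed
qed

text \<open>Common core of both ideal conditions. The guilty letter exceeds \<open>\<delta>\<close>
  at its old position, which lies after a peak because the letter respects the running maximum; at
  its new position the bound is no larger.\<close>

lemma non_cliff_move_right:
  assumes \<delta>: "unimodal \<delta>" and w: "w \<in> cliffs (range_bar \<delta>) - cliffs \<delta>"
    and move: "\<And>k. k < length w \<Longrightarrow> \<exists>k'\<ge>k. k' < length w' \<and> w' ! k' = w ! k"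
  shows "w' \<notin> cliffs \<delta>"
proof -
  obtain k where k: "k < length w" "\<delta> (Suc k) < w ! k" "w ! k \<le> range_bar \<delta> (Suc k)"
    using w by (auto simp: cliffs_iff not_le)
  obtain k' where k': "k \<le> k'" "k' < length w'" "w' ! k' = w ! k"
    using move[OF k(1)] by auto
  have "\<delta> (Suc k') \<le> \<delta> (Suc k)"
    using k k' by (intro unimodal_after_peak[OF \<delta>]) auto
  then show ?thesis
    using k k' unfolding cliffs_iff by (auto simp: not_le intro!: exI[of _ k'])
qed

lemma word_insert_non_cliff_left:
  assumes "unimodal \<delta>" "p \<le> length u" "u \<in> cliffs (range_bar \<delta>) - cliffs \<delta>"
  shows "word_insert u (Suc p) v \<notin> cliffs \<delta>"
proof (rule non_cliff_move_right[OF assms(1,3)])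
  fix k assume "k < length u"
  then show "\<exists>k'\<ge>k. k' < length (word_insert u (Suc p) v) \<and> word_insert u (Suc p) v ! k' = u ! k"
    \<comment> \<open>Letters of \<open>u\<close> before the insertion stay in place, the others
      move by the length of \<open>v\<close>.\<close>
    using assms(2) by (intro exI[of _ "if k < p then k else k + length v"])
      (simp add: length_word_insert nth_word_insert)
qed

lemma word_insert_non_cliff_right:
  assumes "unimodal \<delta>" "p \<le> length u" "v \<in> cliffs (range_bar \<delta>) - cliffs \<delta>"
  shows "word_insert u (Suc p) v \<notin> cliffs \<delta>"
proof (rule non_cliff_move_right[OF assms(1,3)])
  fix k assume "k < length v"
  then show "\<exists>k'\<ge>k. k' < length (word_insert u (Suc p) v) \<and> word_insert u (Suc p) v ! k' = v ! k"
    using assms(2) by (intro exI[of _ "p + k"])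
      (simp add: length_word_insert nth_word_insert)
qed


section \<open>The cliff operad\<close>

context cring
begin

lemma finsum_delta:
  assumes "finite A" "c \<in> carrier R"
  shows "(\<Oplus>a\<in>A. if b = a then c else \<zero>) = (if b \<in> A then c else \<zero>)"
proof (cases "b \<in> A")
  case True
  then show ?thesis
    using finsum_singleton[of b A "\<lambda>_. c"] assms by simp
next
  case False
  then have "(\<Oplus>a\<in>A. if b = a then c else \<zero>) = (\<Oplus>a\<in>A. \<zero>)"
    by (intro finsum_cong') auto
  with False show ?thesis by simp
qed

lemma cliff_space_supp:
  assumes "x \<in> carrier (cliff_space R \<rho> n)" "u \<in> supp R x"
  shows "u \<in> cliffs \<rho>" "Suc (length u) = n"
  using assms by (auto simp: cliff_space_def word_size_def)

lemma module_cliff_space: "module R (cliff_space R \<rho> n)"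
  unfolding cliff_space_def by (rule module_free_module)

lemma cliff_space_closed: "x \<in> carrier (cliff_space R \<rho> n) \<Longrightarrow> x w \<in> carrier R"
  unfolding cliff_space_def by (rule free_module_closed)

text \<open>Every word has size at least 1. This settles the cases where an arity is 0 and
  \<open>m - 1\<close> is not a true predecessor.\<close>

lemma cliff_space_0: "x \<in> carrier (cliff_space R \<rho> 0) \<Longrightarrow> x w = \<zero>"
  unfolding cliff_space_def by (erule free_module_eq_zero) (simp add: word_size_def)

text \<open>The place of composition is \<open>Suc p\<close>, so \<open>p\<close> counts the letters
  of the outer word in front of the inserted one.\<close>

context
  fixes \<rho> n m p x y
  assumes \<rho>: "mono_on {1..} \<rho>" and p: "p < n"
    and x: "x \<in> carrier (cliff_space R \<rho> n)" and y: "y \<in> carrier (cliff_space R \<rho> m)"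
begin

lemma cliff_term_closed:
  assumes "u \<in> supp R x" "v \<in> supp R y"
  shows "(x u \<otimes> y v) \<odot>\<^bsub>cliff_space R \<rho> (n + m - 1)\<^esub> basis_elem R (word_insert u (Suc p) v)
    \<in> carrier (cliff_space R \<rho> (n + m - 1))"
proof -
  note u = cliff_space_supp[OF x assms(1)] and v = cliff_space_supp[OF y assms(2)]
  have "word_insert u (Suc p) v \<in> {w \<in> cliffs \<rho>. word_size w = n + m - 1}"
    using u v p by (auto simp: word_size_def length_word_insert intro!: word_insert_in_cliffs \<rho>)
  then have "basis_elem R (word_insert u (Suc p) v) \<in> carrier (cliff_space R \<rho> (n + m - 1))"
    unfolding cliff_space_def by (rule basis_elem_closed)
  then show ?thesis
    by (intro module.smult_closed[OF module_cliff_space] m_closed cliff_space_closed[OF x]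
        cliff_space_closed[OF y])
qed

lemma cliff_pcomp_closed:
  "pcomp (cliff_operad R \<rho>) n m (Suc p) x y \<in> carrier (cliff_space R \<rho> (n + m - 1))"
proof -
  interpret M: module R "cliff_space R \<rho> (n + m - 1)" by (rule module_cliff_space)
  show ?thesis
    unfolding cliff_operad_def operad_data.simps
    by (intro M.finsum_closed funcsetI cliff_term_closed)
qed

text \<open>A word splits in at most one way as an insertion of words of given lengths at a given place,
  so the bilinear extension has a closed form, in which the operad axioms become identities
  between subwords.\<close>

lemma cliff_pcomp_eq:
  "pcomp (cliff_operad R \<rho>) n m (Suc p) x y
    = (\<lambda>w. x (outer_word p (m - 1) w) \<otimes> y (inner_word p (m - 1) w))"
proof
  fix w
  interpret M: module R "cliff_space R \<rho> (n + m - 1)" by (rule module_cliff_space)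
  let ?u = "outer_word p (m - 1) w" and ?v = "inner_word p (m - 1) w"
  define c where "c = x ?u \<otimes> y ?v"
  have fin: "finite (supp R x)" "finite (supp R y)"
    using x y by (simp_all add: cliff_space_def)
  have c: "c \<in> carrier R"
    using cliff_space_closed[OF x] cliff_space_closed[OF y] by (simp add: c_def)
  \<comment> \<open>Arity fixes the lengths of all words in the supports, so \<open>w\<close> comes
    from at most one pair of words.\<close>
  have split: "w = word_insert u (Suc p) v \<longleftrightarrow> ?u = u \<and> ?v = v"
    if "u \<in> supp R x" "v \<in> supp R y" for u v
  proof -
    have "p \<le> length u" "m - 1 = length v"
      using cliff_space_supp[OF x that(1)] cliff_space_supp[OF y that(2)] p by auto
    then show ?thesis
      using outer_word_insert inner_word_insert word_insert_outer_inner by metis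
  qed
  have "pcomp (cliff_operad R \<rho>) n m (Suc p) x y w
      = (\<Oplus>u\<in>supp R x. \<Oplus>v\<in>supp R y. (x u \<otimes> y v) \<otimes> basis_elem R (word_insert u (Suc p) v) w)"
  proof -
    note closed = cliff_term_closed[unfolded cliff_space_def]
    have "pcomp (cliff_operad R \<rho>) n m (Suc p) x y w = (\<Oplus>u\<in>supp R x.
        (\<Oplus>\<^bsub>cliff_space R \<rho> (n + m - 1)\<^esub> v \<in> supp R y. (x u \<otimes> y v)
          \<odot>\<^bsub>cliff_space R \<rho> (n + m - 1)\<^esub> basis_elem R (word_insert u (Suc p) v)) w)"
      unfolding cliff_operad_def operad_data.simps cliff_space_def
      by (rule finsum_free_module)
        (intro funcsetI M.finsum_closed[unfolded cliff_space_def] closed)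
    also have "\<dots> = (\<Oplus>u\<in>supp R x. \<Oplus>v\<in>supp R y.
        ((x u \<otimes> y v) \<odot>\<^bsub>cliff_space R \<rho> (n + m - 1)\<^esub> basis_elem R (word_insert u (Suc p) v)) w)"
      unfolding cliff_space_def
    proof (intro finsum_cong' refl funcsetI finsum_closed)
      fix u v assume "u \<in> supp R x" "v \<in> supp R y"
      then show "((x u \<otimes> y v) \<odot>\<^bsub>free_module R {w \<in> cliffs \<rho>. word_size w = n + m - 1}\<^esub>
          basis_elem R (word_insert u (Suc p) v)) w \<in> carrier R"
        by (intro free_module_closed[OF closed])
    next
      fix u assume "u \<in> supp R x"
      then show "(\<Oplus>\<^bsub>free_module R {w \<in> cliffs \<rho>. word_size w = n + m - 1}\<^esub>v\<in>supp R y.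
          (x u \<otimes> y v) \<odot>\<^bsub>free_module R {w \<in> cliffs \<rho>. word_size w = n + m - 1}\<^esub>
          basis_elem R (word_insert u (Suc p) v)) w = (\<Oplus>v\<in>supp R y.
          ((x u \<otimes> y v) \<odot>\<^bsub>free_module R {w \<in> cliffs \<rho>. word_size w = n + m - 1}\<^esub>
          basis_elem R (word_insert u (Suc p) v)) w)"
        by (intro finsum_free_module funcsetI closed)
    qed
    finally show ?thesis
      by (simp add: cliff_space_def)
  qed
  \<comment> \<open>Only the pair cut out of \<open>w\<close> contributes, with coefficient
    \<open>c\<close>. The nesting of the conditions lets \<open>finsum_delta\<close> collapse the
    sum over \<open>v\<close> first, then the one over \<open>u\<close>.\<close>
  also have "\<dots> = (\<Oplus>u\<in>supp R x. \<Oplus>v\<in>supp R y. if ?v = v then if ?u = u then c else \<zero> else \<zero>)"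
    using cliff_space_closed[OF x] cliff_space_closed[OF y] c
    by (intro finsum_cong' refl funcsetI finsum_closed)
      (auto simp: basis_elem_def split c_def)
  also have "\<dots> = (\<Oplus>u\<in>supp R x. if ?v \<in> supp R y then if ?u = u then c else \<zero> else \<zero>)"
    using fin c by (intro finsum_cong' refl funcsetI) (simp_all add: finsum_delta)
  also have "\<dots> = (if ?v \<in> supp R y then if ?u \<in> supp R x then c else \<zero> else \<zero>)"
    using fin c by (simp add: finsum_delta)
  also have "\<dots> = c"
    using cliff_space_closed[OF x] cliff_space_closed[OF y] by (auto simp: c_def supp_def)
  finally show "pcomp (cliff_operad R \<rho>) n m (Suc p) x y w = x ?u \<otimes> y ?v"
    by (simp only: c_def)
qed

end

lemma cliff_space_simps:
  "x \<oplus>\<^bsub>cliff_space R \<rho> n\<^esub> y = (\<lambda>w. x w \<oplus> y w)"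
  "a \<odot>\<^bsub>cliff_space R \<rho> n\<^esub> x = (\<lambda>w. a \<otimes> x w)"
  by (simp_all add: cliff_space_def)

lemma component_cliff_operad: "component (cliff_operad R \<rho>) n = cliff_space R \<rho> n"
  by (simp add: cliff_operad_def)

lemma unit_cliff_operad: "operad_unit (cliff_operad R \<rho>) = basis_elem R []"
  by (simp add: cliff_operad_def)

lemma unit_in_cliff_space: "basis_elem R [] \<in> carrier (cliff_space R \<rho> 1)"
  unfolding cliff_space_def by (rule basis_elem_closed) (simp add: cliffs_def word_size_def)

end

section \<open>Operad axioms for the cliff compositions\<close>

theorem (in field) ns_operad_cliff_operad:
  assumes \<rho>: "mono_on {1..} \<rho>"
  shows "ns_operad R (cliff_operad R \<rho>)"
proof -
  note eq = cliff_pcomp_eq[OF \<rho>]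
  note closed = cliff_pcomp_closed[OF \<rho>]
  note add_closed = abelian_monoid.a_closed[OF abelian_group.axioms(1)[OF module.axioms(2)[OF module_cliff_space]]]
  note smult_closed = module.smult_closed[OF module_cliff_space]
  show ?thesis
  proof (rule ns_operad.intro, unfold component_cliff_operad unit_cliff_operad, goal_cases)
    case 1 show ?case by (rule field_axioms)
  next
    case (2 n) show ?case by (rule module_cliff_space)
  next
    case (3 n m i x y)
    then obtain p where "i = Suc p" "p < n" by (cases i) auto
    with 3 show ?case by (simp only: closed)
  next
    case (4 n m i x x' y)
    then obtain p where "i = Suc p" "p < n" by (cases i) auto
    with 4 show ?case
      using 4(3-5)[THEN cliff_space_closed]
      by (simp only: eq add_closed) (simp add: cliff_space_simps l_distr)
  next
    case (5 n m i x y y')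
    then obtain p where "i = Suc p" "p < n" by (cases i) auto
    with 5 show ?case
      using 5(3-5)[THEN cliff_space_closed]
      by (simp only: eq add_closed) (simp add: cliff_space_simps r_distr)
  next
    case (6 n m i a x y)
    then obtain p where "i = Suc p" "p < n" by (cases i) auto
    with 6 show ?case
      using 6(4-5)[THEN cliff_space_closed]
      by (simp only: eq smult_closed) (simp add: cliff_space_simps m_assoc)
  next
    case (7 n m i a x y)
    then obtain p where "i = Suc p" "p < n" by (cases i) auto
    with 7 show ?case
      using 7(4-5)[THEN cliff_space_closed]
      by (simp only: eq smult_closed) (simp add: cliff_space_simps m_lcomm)
  next
    case (8 n m k i j x y z)
    then obtain p q where pq: "i = Suc p" "p < n" "j = Suc q" "q < m" "i + j - 1 = Suc (p + q)"
      "p + q < n + m - 1" by (cases i; cases j) auto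
    note c = 8(5-7)[THEN cliff_space_closed]
    have "pcomp (cliff_operad R \<rho>) (n + m - 1) k (Suc (p + q))
          (pcomp (cliff_operad R \<rho>) n m (Suc p) x y) z
        = (\<lambda>w. x (outer_word p (m - 1) (outer_word (p + q) (k - 1) w))
          \<otimes> y (inner_word p (m - 1) (outer_word (p + q) (k - 1) w))
          \<otimes> z (inner_word (p + q) (k - 1) w))"
      by (simp only: eq[OF pq(6) closed[OF pq(2) 8(5,6)] 8(7)]) (simp only: eq[OF pq(2) 8(5,6)])
    also have "\<dots> = (\<lambda>w. x (outer_word p (m + k - 1 - 1) w)
          \<otimes> (y (outer_word q (k - 1) (inner_word p (m + k - 1 - 1) w))
            \<otimes> z (inner_word q (k - 1) (inner_word p (m + k - 1 - 1) w))))"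
    \<comment> \<open>In arity 0 the element \<open>z\<close> vanishes and so do both sides.
      Otherwise the combined factor has length \<open>(m - 1) + r\<close>, as the sequential word
      identities require.\<close>
    proof (cases k)
      case 0
      then show ?thesis using 8(7) c by (simp add: cliff_space_0)
    next
      case (Suc r)
      then have "m + k - 1 - 1 = m - 1 + r" "q \<le> m - 1" using pq by auto
      then show ?thesis
        using Suc c by (simp add: outer_outer_sequential inner_outer_sequential
            inner_sequential[of q "m - 1" p r] m_assoc)
    qed
    also have "\<dots> = pcomp (cliff_operad R \<rho>) n (m + k - 1) (Suc p) x
        (pcomp (cliff_operad R \<rho>) m k (Suc q) y z)"
      by (simp only: eq[OF pq(2) 8(5) closed[OF pq(4) 8(6,7)]]) (simp only: eq[OF pq(4) 8(6,7)])
    finally show ?case by (simp only: pq(5)) (simp only: pq(1,3))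
  next
    case (9 n m k i j x y z)
    then obtain p q where pq: "i = Suc p" "p < n" "j = Suc q" "q < n" "p < q"
      "j + m - 1 = Suc (q + m - 1)" "q + m - 1 < n + m - 1" "p < n + k - 1"
      by (cases i; cases j) auto
    note c = 9(4-6)[THEN cliff_space_closed]
    have "pcomp (cliff_operad R \<rho>) (n + m - 1) k (Suc (q + m - 1))
          (pcomp (cliff_operad R \<rho>) n m (Suc p) x y) z
        = (\<lambda>w. x (outer_word p (m - 1) (outer_word (q + m - 1) (k - 1) w))
          \<otimes> y (inner_word p (m - 1) (outer_word (q + m - 1) (k - 1) w))
          \<otimes> z (inner_word (q + m - 1) (k - 1) w))"
      by (simp only: eq[OF pq(7) closed[OF pq(2) 9(4,5)] 9(6)]) (simp only: eq[OF pq(2) 9(4,5)])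
    also have "\<dots> = (\<lambda>w. x (outer_word q (k - 1) (outer_word p (m - 1) w))
          \<otimes> z (inner_word q (k - 1) (outer_word p (m - 1) w))
          \<otimes> y (inner_word p (m - 1) w))"
    \<comment> \<open>Again arity 0 gives zero on both sides; for \<open>m = Suc l\<close> the
      second cut is at \<open>q + l\<close>, as in the parallel word identities.\<close>
    proof (cases m)
      case 0
      then show ?thesis using 9(5) c by (simp add: cliff_space_0)
    next
      case (Suc l)
      then show ?thesis
        using pq c by (simp add: outer_outer_parallel inner_outer_parallel
            inner_parallel[of p q l] m_ac)
    qed
    also have "\<dots> = pcomp (cliff_operad R \<rho>) (n + k - 1) m (Suc p)
        (pcomp (cliff_operad R \<rho>) n k (Suc q) x z) y"
      by (simp only: eq[OF pq(8) closed[OF pq(4) 9(4,6)] 9(5)]) (simp only: eq[OF pq(4) 9(4,6)])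
    finally show ?case by (simp only: pq(6)) (simp only: pq(1,3))
  next
    case 10 show ?case by (rule unit_in_cliff_space)
  next
    case (11 n x)
    show ?case
    proof
      fix w
      \<comment> \<open>The unit leaves a nonzero coefficient only where the outer word is empty,
        that is for words of length at most \<open>n - 1\<close>, on which
        \<open>take (n - 1)\<close> is the identity. On longer words \<open>x\<close> vanishes by
        arity.\<close>
      have "x w = \<zero>" if "length w \<noteq> n - 1"
        by (rule free_module_eq_zero[OF 11[unfolded cliff_space_def]])
          (use that in \<open>auto simp: word_size_def\<close>)
      moreover have "outer_word 0 (n - 1) w = [] \<longleftrightarrow> length w \<le> n - 1"
        by (simp add: outer_word_def)
      moreover have "x (take (n - 1) w) = x w" if "length w \<le> n - 1"
        using that by simp
      ultimately show "pcomp (cliff_operad R \<rho>) 1 n 1 (basis_elem R []) x w = x w"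
        using 11 cliff_space_closed[OF 11] eq[OF zero_less_one unit_in_cliff_space 11]
        by (auto simp: basis_elem_def inner_word_def)
    qed
  next
    case (12 n i x)
    then obtain p where "i = Suc p" "p < n" by (cases i) auto
    \<comment> \<open>The unit has arity 1, so the cut has length 0: the inner word is empty and the
      outer word is the whole word.\<close>
    with 12 show ?case
      using cliff_space_closed[OF 12(3)] eq[OF _ 12(3) unit_in_cliff_space]
      by (simp add: basis_elem_def inner_word_def outer_word_def)
  qed
qed

section \<open>The ideal of non-cliffs\<close>

lemma (in cring) non_cliff_space_eq:
  "non_cliff_space R \<delta> n
    = carrier (free_module R {w \<in> cliffs (range_bar \<delta>) - cliffs \<delta>. word_size w = n})"
  unfolding non_cliff_space_def cliff_space_def by (rule module_span_basis) auto

text \<open>Turns membership in a span into a test of coefficients at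
  \<open>\<delta>\<close>-cliffs, to which the closed form of the composition applies
  directly.\<close>

lemma (in cring) non_cliff_space_iff:
  "x \<in> non_cliff_space R \<delta> n \<longleftrightarrow>
    x \<in> carrier (cliff_space R (range_bar \<delta>) n) \<and> (\<forall>w\<in>cliffs \<delta>. x w = \<zero>)"
  unfolding non_cliff_space_eq cliff_space_def by (auto simp: supp_def)

theorem (in field) operad_ideal_non_cliff_space:
  assumes \<delta>: "unimodal \<delta>"
  shows "operad_ideal R (cliff_operad R (range_bar \<delta>)) (non_cliff_space R \<delta>)"
proof (intro operad_ideal.intro operad_ideal_axioms.intro, unfold component_cliff_operad, goal_cases)
  case 1
  show ?case by (rule ns_operad_cliff_operad[OF mono_on_range_bar])
next
  case (2 n)
  show ?case
    unfolding non_cliff_space_eq cliff_space_def by (rule submodule_free_module) auto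
next
  case (3 n m i x y)
  then obtain p where p: "i = Suc p" "p < n" by (cases i) auto
  have x: "x \<in> carrier (cliff_space R (range_bar \<delta>) n)"
    using 3 by (simp add: non_cliff_space_iff)
  note y = 3(4)
  \<comment> \<open>The product is the coefficient of the composition at \<open>w\<close>. If it
    were nonzero, the outer word would be a non-cliff in the support of \<open>x\<close>, and
    reinserting the inner word would give the cliff \<open>w\<close>.\<close>
  have "x (outer_word p (m - 1) w) \<otimes> y (inner_word p (m - 1) w) = \<zero>" if "w \<in> cliffs \<delta>" for w
  proof (rule ccontr)
    let ?u = "outer_word p (m - 1) w"
    assume "\<not> ?thesis"
    then have "?u \<in> supp R x"
      using cliff_space_closed[OF y] by (auto simp: supp_def)
    then have "p \<le> length ?u" "?u \<in> cliffs (range_bar \<delta>) - cliffs \<delta>"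
      using cliff_space_supp[OF x] p 3(3) by (fastforce simp: non_cliff_space_iff supp_def)+
    then show False
      using word_insert_non_cliff_left[OF \<delta>] word_insert_outer_inner that by metis
  qed
  then show ?case
    unfolding p non_cliff_space_iff
    using cliff_pcomp_closed[OF mono_on_range_bar p(2) x y]
      cliff_pcomp_eq[OF mono_on_range_bar p(2) x y] by simp
next
  case (4 n m i x y)
  then obtain p where p: "i = Suc p" "p < n" by (cases i) auto
  have y: "y \<in> carrier (cliff_space R (range_bar \<delta>) m)"
    using 4 by (simp add: non_cliff_space_iff)
  note x = 4(3)
  have "x (outer_word p (m - 1) w) \<otimes> y (inner_word p (m - 1) w) = \<zero>" if "w \<in> cliffs \<delta>" for w
  proof (rule ccontr)
    let ?u = "outer_word p (m - 1) w" and ?v = "inner_word p (m - 1) w"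
    assume "\<not> ?thesis"
    \<comment> \<open>The guilty word is now \<open>?v\<close>; the support of \<open>x\<close>
      still serves to bound \<open>p\<close> by the length of \<open>?u\<close>, which reinsertion
      requires.\<close>
    then have "?u \<in> supp R x" "?v \<in> supp R y"
      using cliff_space_closed[OF x] cliff_space_closed[OF y] by (auto simp: supp_def)
    then have "p \<le> length ?u" "?v \<in> cliffs (range_bar \<delta>) - cliffs \<delta>"
      using cliff_space_supp[OF x] cliff_space_supp[OF y] p 4(4)
      by (fastforce simp: non_cliff_space_iff supp_def)+
    then show False
      using word_insert_non_cliff_right[OF \<delta>] word_insert_outer_inner that by metis
  qed
  then show ?case
    unfolding p non_cliff_space_iff
    using cliff_pcomp_closed[OF mono_on_range_bar p(2) x y]
      cliff_pcomp_eq[OF mono_on_range_bar p(2) x y] by simp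
qed

theorem theorem2p1p2:
  fixes K :: "('k, 'r) ring_scheme" and \<delta> :: "nat \<Rightarrow> nat"
  assumes "field K" and "char_zero K"
    and "unimodal \<delta>"
  shows "ns_operad K (quotient_operad (cliff_operad K (range_bar \<delta>)) (non_cliff_space K \<delta>))"
  using assms by (intro operad_ideal.ns_operad_quotient field.operad_ideal_non_cliff_space)

end
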